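(* Let $0<p<\infty$ and $A\in L^q(D,\mathbb{B})$ with $q>2$. Let $f\in H_{A,0}(D,\mathbb{B})$ and write $f=\varphi e^{\phi}$, where $\phi=T_{\mathbb{B}}(A)$ and $\varphi\in Hol(D,\mathbb{B})$. Then $f\in H^p_{A,0}(D,\mathbb{B})$ if and only if $\varphi\in H^p(D,\mathbb{B})$.
   Context: $D$ is the open unit disk in $\mathbb{C}$. For $u\in\mathbb{C}$, $u^*$ denotes the complex conjugate; $\frac{\partial}{\partial z}=\frac12(\partial_x-i\partial_y)$, $\frac{\partial}{\partial z^*}=\frac12(\partial_x+i\partial_y)$. $\mathbb{B}$ denotes the bicomplex numbers: the commutative $\mathbb{C}$-algebra of elements $z_1+jz_2$ with $z_1,z_2\in\mathbb{C}$, $j^2=-1$, $ij=ji$. Put $p^\pm=\frac12(1\pm ij)$ (idempotents with $p^+p^-=0$). Each $w=z_1+jz_2\in\mathbb{B}$ is uniquely $w=p^+w^++p^-w^-$ with $w^\pm=z_1\mp iz_2\in\mathbb{C}$; for functions, $f^\pm$ is defined pointwise. $\|w\|_{\mathbb{B}}=\sqrt{(|w^+|^2+|w^-|^2)/2}$ and $e^w=p^+e^{w^+}+p^-e^{w^-}$. $L^q(D,\mathbb{B})$ is the set of $f:D\to\mathbb{B}$ with $\iint_D\|f\|_{\mathbb{B}}^q\,dx\,dy<\infty$. $\bar\partial=\frac12(\partial_x+j\partial_y)=p^+\frac{\partial}{\partial z}+p^-\frac{\partial}{\partial z^*}$, derivatives being understood in the weak sense. $Hol(D,\mathbb{B})$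 is the set of $f:D\to\mathbb{B}$ with $\bar\partial f=0$, equivalently with $(f^+)^*$ and $f^-$ ordinary holomorphic functions. $H_{A,0}(D,\mathbb{B})$ is the set of $f:D\to\mathbb{B}$ with $\bar\partial f=Af$. For $0<p<\infty$, $\|f\|_{H^p_{\mathbb{B}}}=\sup_{0<r<1}\left(\int_0^{2\pi}\|f(re^{i\theta})\|_{\mathbb{B}}^p\,d\theta\right)^{1/p}$; $H^p(D,\mathbb{B})$ (resp. $H^p_{A,0}(D,\mathbb{B})$) is the set of $f\in Hol(D,\mathbb{B})$ (resp. $f\in H_{A,0}(D,\mathbb{B})$) with $\|f\|_{H^p_{\mathbb{B}}}<\infty$. The bicomplex Theodorescu operator is $$T_{\mathbb{B}}(g)(z)=p^+\left(-\frac1\pi\iint_D\frac{g^+(\zeta)}{\zeta^*-z^*}\,d\xi\,d\eta\right)+p^-\left(-\frac1\pi\iint_D\frac{g^-(\zeta)}{\zeta-z}\,d\xi\,d\eta\right),\quad \zeta=\xi+i\eta.$$ It is known that every $f\in H_{A,0}(D,\mathbb{B})$ can be written $f=\varphi e^{T_{\mathbb{B}}(A)}$ with $\varphi\in Hol(D,\mathbb{B})$; $f$ is identified with this continuous representative. *)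

theory Defs
  imports "HOL-Analysis.Analysis"
begin

section \<open>Bicomplex numbers\<close>

text \<open>\<open>Bicomplex z1 z2\<close> stands for \<open>z1 + j z2\<close>.\<close>

datatype bicomplex = Bicomplex (bc_fst: complex) (bc_snd: complex)

instantiation bicomplex :: comm_ring_1
begin

definition "0 = Bicomplex 0 0"
definition "1 = Bicomplex 1 0"
definition "v + w = Bicomplex (bc_fst v + bc_fst w) (bc_snd v + bc_snd w)"
definition "v - w = Bicomplex (bc_fst v - bc_fst w) (bc_snd v - bc_snd w)"
definition "- w = Bicomplex (- bc_fst w) (- bc_snd w)"
definition "v * w = Bicomplex (bc_fst v * bc_fst w - bc_snd v * bc_snd w)
                              (bc_fst v * bc_snd w + bc_snd v * bc_fst w)"

lemmas bicomplex_defs =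
  zero_bicomplex_def one_bicomplex_def plus_bicomplex_def
  minus_bicomplex_def uminus_bicomplex_def times_bicomplex_def

instance
  by standard (simp_all add: bicomplex_defs algebra_simps)

end

definition bc_of_complex :: "complex \<Rightarrow> bicomplex"
  where "bc_of_complex z = Bicomplex z 0"

definition bc_j :: bicomplex
  where "bc_j = Bicomplex 0 1"

definition p_plus :: bicomplex
  where "p_plus = bc_of_complex (1/2) * (1 + bc_of_complex \<i> * bc_j)"

definition p_minus :: bicomplex
  where "p_minus = bc_of_complex (1/2) * (1 - bc_of_complex \<i> * bc_j)"

definition bc_plus :: "bicomplex \<Rightarrow> complex"
  where "bc_plus w = bc_fst w - \<i> * bc_snd w"

definition bc_minus :: "bicomplex \<Rightarrow> complex"
  where "bc_minus w = bc_fst w + \<i> * bc_snd w"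

lemma Bicomplex_eq: "Bicomplex z1 z2 = bc_of_complex z1 + bc_j * bc_of_complex z2"
  by (simp add: bicomplex_defs bc_of_complex_def bc_j_def)

lemma bc_j_squared: "bc_j * bc_j = - 1"
  by (simp add: bicomplex_defs bc_j_def)

lemma p_idempotent:
  "p_plus * p_plus = p_plus" "p_minus * p_minus = p_minus" "p_plus * p_minus = 0"
  by (simp_all add: bicomplex_defs p_plus_def p_minus_def bc_of_complex_def bc_j_def)

lemma bc_decomposition:
  "w = p_plus * bc_of_complex a + p_minus * bc_of_complex b
     \<longleftrightarrow> a = bc_plus w \<and> b = bc_minus w"
  by (cases w)
    (auto simp: bicomplex_defs p_plus_def p_minus_def bc_of_complex_def bc_j_def
        bc_plus_def bc_minus_def complex_eq_iff field_simps)

definition bc_norm :: "bicomplex \<Rightarrow> real"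
  where "bc_norm w = sqrt (((cmod (bc_plus w))\<^sup>2 + (cmod (bc_minus w))\<^sup>2) / 2)"

definition bc_exp :: "bicomplex \<Rightarrow> bicomplex"
  where "bc_exp w = p_plus * bc_of_complex (exp (bc_plus w))
                    + p_minus * bc_of_complex (exp (bc_minus w))"


section \<open>Weak derivatives on the unit disk\<close>

text \<open>Functions on the disk are total functions whose values outside it are irrelevant.\<close>

abbreviation unit_disk :: "complex set"
  where "unit_disk \<equiv> ball 0 1"

text \<open>Here \<open>differentiable\<close> and \<open>frechet_derivative\<close> are over the reals, so the partial
  derivatives in \<open>x\<close> and \<open>y\<close> are the derivatives in the directions \<open>1\<close> and \<open>\<i>\<close>.\<close>

definition partial_x :: "(complex \<Rightarrow> complex) \<Rightarrow> complex \<Rightarrow> complex"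
  where "partial_x u z = frechet_derivative u (at z) 1"

definition partial_y :: "(complex \<Rightarrow> complex) \<Rightarrow> complex \<Rightarrow> complex"
  where "partial_y u z = frechet_derivative u (at z) \<i>"

definition partial_z :: "(complex \<Rightarrow> complex) \<Rightarrow> complex \<Rightarrow> complex"
  where "partial_z u z = (partial_x u z - \<i> * partial_y u z) / 2"

definition partial_zbar :: "(complex \<Rightarrow> complex) \<Rightarrow> complex \<Rightarrow> complex"
  where "partial_zbar u z = (partial_x u z + \<i> * partial_y u z) / 2"

primrec C_diff :: "nat \<Rightarrow> (complex \<Rightarrow> complex) \<Rightarrow> bool"
  where
    "C_diff 0 u \<longleftrightarrow> continuous_on UNIV u"
  | "C_diff (Suc k) u \<longleftrightarrow>
       (\<forall>z. u differentiable (at z)) \<and> C_diff k (partial_x u) \<and> C_diff k (partial_y u)"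

definition test_functions :: "(complex \<Rightarrow> complex) set"
  where "test_functions =
    {\<psi>. (\<forall>k. C_diff k \<psi>) \<and> compact (closure {z. \<psi> z \<noteq> 0})
         \<and> closure {z. \<psi> z \<noteq> 0} \<subseteq> unit_disk}"

definition locally_integrable :: "(complex \<Rightarrow> complex) \<Rightarrow> bool"
  where "locally_integrable u \<longleftrightarrow>
    (\<forall>K. compact K \<and> K \<subseteq> unit_disk \<longrightarrow> set_integrable lebesgue K u)"

definition weak_partial_z :: "(complex \<Rightarrow> complex) \<Rightarrow> (complex \<Rightarrow> complex) \<Rightarrow> bool"
  where "weak_partial_z u v \<longleftrightarrow> locally_integrable u \<and> locally_integrable v \<and>
    (\<forall>\<psi>\<in>test_functions.
       (LINT z:unit_disk|lebesgue. u z * partial_z \<psi> z)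
         = - (LINT z:unit_disk|lebesgue. v z * \<psi> z))"

definition weak_partial_zbar :: "(complex \<Rightarrow> complex) \<Rightarrow> (complex \<Rightarrow> complex) \<Rightarrow> bool"
  where "weak_partial_zbar u v \<longleftrightarrow> locally_integrable u \<and> locally_integrable v \<and>
    (\<forall>\<psi>\<in>test_functions.
       (LINT z:unit_disk|lebesgue. u z * partial_zbar \<psi> z)
         = - (LINT z:unit_disk|lebesgue. v z * \<psi> z))"

text \<open>\<open>weak_dbar f g\<close> says \<open>(p\<^sup>+ \<partial>/\<partial>z + p\<^sup>- \<partial>/\<partial>z\<^sup>*) f = g\<close> weakly
  on the disk.\<close>

definition weak_dbar :: "(complex \<Rightarrow> bicomplex) \<Rightarrow> (complex \<Rightarrow> bicomplex) \<Rightarrow> bool"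
  where "weak_dbar f g \<longleftrightarrow>
    weak_partial_z (\<lambda>z. bc_plus (f z)) (\<lambda>z. bc_plus (g z)) \<and>
    weak_partial_zbar (\<lambda>z. bc_minus (f z)) (\<lambda>z. bc_minus (g z))"


section \<open>Function spaces\<close>

definition bc_Lq :: "real \<Rightarrow> (complex \<Rightarrow> bicomplex) set"
  where "bc_Lq q = {g.
    (\<lambda>z. bc_plus (g z)) \<in> borel_measurable (lebesgue_on unit_disk) \<and>
    (\<lambda>z. bc_minus (g z)) \<in> borel_measurable (lebesgue_on unit_disk) \<and>
    (\<integral>\<^sup>+z. ennreal (bc_norm (g z) powr q) \<partial>lebesgue_on unit_disk) < \<infinity>}"

definition bc_continuous_on_disk :: "(complex \<Rightarrow> bicomplex) \<Rightarrow> bool"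
  where "bc_continuous_on_disk f \<longleftrightarrow>
    continuous_on unit_disk (\<lambda>z. bc_plus (f z)) \<and>
    continuous_on unit_disk (\<lambda>z. bc_minus (f z))"

text \<open>A weak solution is determined only almost everywhere. Since the Hardy norms below depend
  on values on circles, solutions are always taken to be the continuous representatives.\<close>

definition bc_Hol :: "(complex \<Rightarrow> bicomplex) set"
  where "bc_Hol = {f. bc_continuous_on_disk f \<and> weak_dbar f (\<lambda>z. 0)}"

definition bc_H :: "(complex \<Rightarrow> bicomplex) \<Rightarrow> (complex \<Rightarrow> bicomplex) set"
  where "bc_H A = {f. bc_continuous_on_disk f \<and> weak_dbar f (\<lambda>z. A z * f z)}"

text \<open>The inner integral is the Bochner integral, which would be \<open>0\<close> for a non-integrable
  function; for continuous \<open>f\<close> the integrand is continuous. The supremum is taken in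
  \<open>ennreal\<close>, so it may be infinite.\<close>

definition bc_Hardy_norm :: "real \<Rightarrow> (complex \<Rightarrow> bicomplex) \<Rightarrow> ennreal"
  where "bc_Hardy_norm p f =
    (SUP r\<in>{0<..<1::real}.
       ennreal ((LINT \<theta>:{0..2*pi}|lborel.
                   bc_norm (f (complex_of_real r * exp (\<i> * complex_of_real \<theta>))) powr p)
                powr (1/p)))"

definition bc_Hardy :: "real \<Rightarrow> (complex \<Rightarrow> bicomplex) set"
  where "bc_Hardy p = {f \<in> bc_Hol. bc_Hardy_norm p f < \<infinity>}"

definition bc_H_Hardy :: "real \<Rightarrow> (complex \<Rightarrow> bicomplex) \<Rightarrow> (complex \<Rightarrow> bicomplex) set"
  where "bc_H_Hardy p A = {f \<in> bc_H A. bc_Hardy_norm p f < \<infinity>}"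

definition Theodorescu :: "(complex \<Rightarrow> bicomplex) \<Rightarrow> complex \<Rightarrow> bicomplex"
  where "Theodorescu g z =
    p_plus * bc_of_complex
      (- (1 / complex_of_real pi) *
        (LINT \<zeta>:unit_disk|lebesgue. bc_plus (g \<zeta>) / (cnj \<zeta> - cnj z)))
    + p_minus * bc_of_complex
      (- (1 / complex_of_real pi) *
        (LINT \<zeta>:unit_disk|lebesgue. bc_minus (g \<zeta>) / (\<zeta> - z)))"

end

theory Submission
  imports Defs
begin

text \<open>
  On the disk \<open>f\<close> and \<open>\<phi>\<close> are comparable up to a constant, so their Hardy norms are finite
  together. Under the idempotent decomposition bicomplex multiplication acts componentwise, and
  \<open>f\<^sup>\<plusminus> = \<phi>\<^sup>\<plusminus> exp (\<Phi>\<^sup>\<plusminus>)\<close> where \<open>\<Phi>\<close> is the Theodorescu transform of \<open>A\<close>. If \<open>\<Phi>\<^sup>\<plusminus>\<close> are bounded by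
  \<open>M\<close>, then \<open>exp (\<Phi>\<^sup>\<plusminus>)\<close> has modulus between \<open>exp (- M)\<close> and \<open>exp M\<close>, hence each of
  \<open>\<parallel>f\<parallel>\<close> and \<open>\<parallel>\<phi>\<parallel>\<close> is pointwise at most \<open>exp M\<close> times the other, and
  \<open>bc_Hardy_norm_le\<close> transfers this to the Hardy norms.

  The boundedness of \<open>\<Phi>\<close> is where \<open>q > 2\<close> enters (\<open>Theodorescu_bounded\<close>): the conjugate
  exponent \<open>s = q / (q - 1)\<close> is below 2, so \<open>\<bar>\<zeta> - z\<bar>\<close> to the power \<open>-s\<close> is integrable over the
  planar disk with a bound that does not depend on \<open>z\<close> (\<open>nn_integral_cauchy_kernel_powr_le\<close>), and
  Young's inequality \<open>a b \<le> a\<^sup>q / q + b\<^sup>s / s\<close> separates \<open>A\<close> from the kernel.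
\<close>

section \<open>Bicomplex norm and idempotent components\<close>

lemma bc_plus_mult: "bc_plus (v * w) = bc_plus v * bc_plus w"
  and bc_minus_mult: "bc_minus (v * w) = bc_minus v * bc_minus w"
  by (simp_all add: bc_plus_def bc_minus_def times_bicomplex_def algebra_simps)

lemma bc_plus_idempotent_sum: "bc_plus (p_plus * bc_of_complex a + p_minus * bc_of_complex b) = a"
  and bc_minus_idempotent_sum: "bc_minus (p_plus * bc_of_complex a + p_minus * bc_of_complex b) = b"
  using bc_decomposition by metis+

lemma cmod_bc_plus_le: "cmod (bc_plus w) \<le> sqrt 2 * bc_norm w"
  and cmod_bc_minus_le: "cmod (bc_minus w) \<le> sqrt 2 * bc_norm w"
  by (auto intro!: real_le_rsqrt simp: bc_norm_def real_sqrt_mult[symmetric])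

lemma bc_norm_nonneg: "0 \<le> bc_norm w"
  by (simp add: bc_norm_def)

lemma bc_norm_le_mult:
  assumes "0 \<le> C" "cmod (bc_plus v) \<le> C * cmod (bc_plus w)"
    "cmod (bc_minus v) \<le> C * cmod (bc_minus w)"
  shows "bc_norm v \<le> C * bc_norm w"
proof -
  have "(cmod (bc_plus v))\<^sup>2 + (cmod (bc_minus v))\<^sup>2
      \<le> (C * cmod (bc_plus w))\<^sup>2 + (C * cmod (bc_minus w))\<^sup>2"
    using assms by (intro add_mono power_mono) auto
  also have "\<dots> = C\<^sup>2 * ((cmod (bc_plus w))\<^sup>2 + (cmod (bc_minus w))\<^sup>2)"
    by (simp add: power_mult_distrib algebra_simps)
  finally have "bc_norm v
      \<le> sqrt (C\<^sup>2 * (((cmod (bc_plus w))\<^sup>2 + (cmod (bc_minus w))\<^sup>2) / 2))"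
    unfolding bc_norm_def by (intro real_sqrt_le_mono) simp
  also have "\<dots> = C * bc_norm w"
    using assms(1) by (simp add: bc_norm_def real_sqrt_mult real_sqrt_divide)
  finally show ?thesis .
qed

section \<open>Boundedness of the Theodorescu transform\<close>

text \<open>
  The kernel is dominated by a step function: if \<open>k\<close> is least with \<open>2\<^sup>-\<^sup>k < \<bar>\<zeta> - z\<bar>\<close>, then
  \<open>\<zeta>\<close> lies in the closed disk \<open>B k\<close> of radius \<open>2 * 2\<^sup>-\<^sup>k\<close> about \<open>z\<close> and the kernel is at most
  \<open>(2\<^sup>s)\<^sup>k\<close>. The area of \<open>B k\<close> is \<open>4 \<pi> / 4\<^sup>k\<close>, so the integrals form a
  geometric series of ratio \<open>2\<^sup>s / 4\<close>, which converges precisely because \<open>s < 2\<close>.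
\<close>

lemma nn_integral_cauchy_kernel_powr_le:
  fixes z :: complex
  assumes "0 < s" "s < 2" "z \<in> unit_disk"
  shows "(\<integral>\<^sup>+\<zeta>. ennreal ((1 / cmod (\<zeta> - z)) powr s) \<partial>lebesgue_on unit_disk)
           \<le> ennreal (4 * pi / (1 - 2 powr s / 4))"
proof -
  define B where "B = (\<lambda>k::nat. cball z (2 * (1/2) ^ k))"
  define c where "c = (\<lambda>k::nat. ennreal ((2 powr s) ^ k))"
  have ratio: "2 powr s / 4 < (1::real)"
    using powr_less_mono[of s 2 2] assms by simp
  have pointwise: "ennreal ((1 / cmod (\<zeta> - z)) powr s) \<le> (\<Sum>k. c k * indicator (B k) \<zeta>)"
    if \<zeta>: "\<zeta> \<in> unit_disk" for \<zeta>
  proof (cases "\<zeta> = z")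
    case True
    \<comment> \<open>Division by zero makes the kernel 0 at its singularity.\<close>
    then show ?thesis by simp
  next
    case False
    define r where "r = cmod (\<zeta> - z)"
    have r: "0 < r" "r \<le> 2"
      using False \<zeta> assms(3) norm_triangle_ineq4[of \<zeta> z] by (auto simp: r_def)
    obtain n where "(1/2) ^ n < r"
      using real_arch_pow_inv[of r "1/2"] r by auto
    then obtain k where k: "(1/2) ^ k < r" and least: "\<And>m. m < k \<Longrightarrow> \<not> (1/2) ^ m < r"
      using exists_least_iff[of "\<lambda>k. (1/2) ^ k < r"] by blast
    have "r \<le> 2 * (1/2) ^ k"
      using r least[of "k - 1"] by (cases k) auto
    then have in_B: "\<zeta> \<in> B k"
      by (simp add: B_def r_def dist_commute dist_norm)
    have "1 / r \<le> 2 ^ k"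
      using k r by (simp add: field_simps)
    then have "(1 / r) powr s \<le> (2 ^ k) powr s"
      using r assms by (intro powr_mono2) auto
    also have "\<dots> = (2 powr s) ^ k"
      by (simp add: powr_realpow[symmetric] powr_powr mult.commute)
    finally have "ennreal ((1 / r) powr s) \<le> c k * indicator (B k) \<zeta>"
      using in_B by (simp add: c_def ennreal_leI)
    also have "\<dots> \<le> (\<Sum>k. c k * indicator (B k) \<zeta>)"
      using sum_le_suminf[OF summableI, of "{k}" "\<lambda>k. c k * indicator (B k) \<zeta> :: ennreal"]
      by (simp del: sum_mult_indicator)
    finally show ?thesis
      by (simp add: r_def)
  qed
  have ball: "c k * emeasure lborel (B k) = ennreal (4 * pi * (2 powr s / 4) ^ k)" for k
    by (simp add: c_def B_def emeasure_cball unit_ball_vol_2 ennreal_mult[symmetric]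
        power_mult_distrib power_divide power2_eq_square field_simps flip: power_mult_distrib)
  have "(\<integral>\<^sup>+\<zeta>. ennreal ((1 / cmod (\<zeta> - z)) powr s) \<partial>lebesgue_on unit_disk)
          \<le> (\<integral>\<^sup>+\<zeta>. (\<Sum>k. c k * indicator (B k) \<zeta>) \<partial>lebesgue)"
    using pointwise
    by (subst nn_integral_restrict_space) (auto intro!: nn_integral_mono split: split_indicator)
  also have "\<dots> = (\<integral>\<^sup>+\<zeta>. (\<Sum>k. c k * indicator (B k) \<zeta>) \<partial>lborel)"
    by (rule nn_integral_completion)
  also have "\<dots> = (\<Sum>k. c k * emeasure lborel (B k))"
    by (subst nn_integral_suminf) (auto intro!: borel_measurable_times_ennreal borel_measurable_indicator
        simp: B_def nn_integral_cmult_indicator)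
  also have "\<dots> = ennreal (4 * pi / (1 - 2 powr s / 4))"
    unfolding ball using ratio
    by (subst suminf_ennreal2)
       (auto intro!: summable_mult summable_geometric
             simp: suminf_mult summable_geometric suminf_geometric)
  finally show ?thesis .
qed

text \<open>
  The kernel enters only through its modulus, so one estimate serves both
  \<open>\<zeta> - z\<close> and its conjugate.
\<close>

lemma cauchy_kernel_integral_bounded:
  fixes g :: "complex \<Rightarrow> complex"
  assumes "2 < q" and g: "g \<in> borel_measurable (lebesgue_on unit_disk)"
    and fin: "(\<integral>\<^sup>+\<zeta>. ennreal (cmod (g \<zeta>) powr q) \<partial>lebesgue_on unit_disk) < \<infinity>"
  shows "\<exists>M. \<forall>z\<in>unit_disk. \<forall>k. (\<forall>\<zeta>. cmod (k \<zeta>) = cmod (\<zeta> - z)) \<longrightarrow>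
           cmod (LINT \<zeta>:unit_disk|lebesgue. g \<zeta> / k \<zeta>) \<le> M"
proof -
  define s where "s = q / (q - 1)"
  have s: "1 < s" "s < 2" "1 / q + 1 / s = 1"
    using assms(1) by (auto simp: s_def field_simps)
  define I where "I = (\<integral>\<^sup>+\<zeta>. ennreal (cmod (g \<zeta>) powr q) \<partial>lebesgue_on unit_disk)"
  define J where "J = ennreal (4 * pi / (1 - 2 powr s / 4))"
  have bound: "cmod (LINT \<zeta>:unit_disk|lebesgue. g \<zeta> / k \<zeta>) \<le> enn2real (I + J)"
    if z: "z \<in> unit_disk" and k: "\<And>\<zeta>. cmod (k \<zeta>) = cmod (\<zeta> - z)" for z k
  proof -
    let ?N = "\<lambda>\<zeta>. ennreal (cmod (g \<zeta> / k \<zeta>))"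
    have young: "cmod (g \<zeta> / k \<zeta>) \<le> cmod (g \<zeta>) powr q + (1 / cmod (\<zeta> - z)) powr s" for \<zeta>
    proof -
      have "cmod (g \<zeta>) * (1 / cmod (\<zeta> - z))
              \<le> cmod (g \<zeta>) powr q / q + (1 / cmod (\<zeta> - z)) powr s / s"
        using assms(1) s by (intro Youngs_inequality) auto
      also have "\<dots> \<le> cmod (g \<zeta>) powr q + (1 / cmod (\<zeta> - z)) powr s"
        using assms(1) s by (intro add_mono) (auto simp: divide_le_eq mult_le_cancel_left1)
      finally show ?thesis
        by (simp add: norm_divide k)
    qed
    have "(\<integral>\<^sup>+\<zeta>. ?N \<zeta> \<partial>lebesgue_on unit_disk)
        \<le> (\<integral>\<^sup>+\<zeta>. ennreal (cmod (g \<zeta>) powr q) + ennreal ((1 / cmod (\<zeta> - z)) powr s)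
              \<partial>lebesgue_on unit_disk)"
      using young by (intro nn_integral_mono) (simp add: ennreal_plus[symmetric] del: ennreal_plus)
    also have "\<dots> = I + (\<integral>\<^sup>+\<zeta>. ennreal ((1 / cmod (\<zeta> - z)) powr s) \<partial>lebesgue_on unit_disk)"
      unfolding I_def
    proof (rule nn_integral_add)
      show "(\<lambda>\<zeta>. ennreal (cmod (g \<zeta>) powr q)) \<in> borel_measurable (lebesgue_on unit_disk)"
        using g by measurable
      have "(\<lambda>\<zeta>. ennreal ((1 / cmod (\<zeta> - z)) powr s)) \<in> borel_measurable borel"
        by measurable
      then show "(\<lambda>\<zeta>. ennreal ((1 / cmod (\<zeta> - z)) powr s))
          \<in> borel_measurable (lebesgue_on unit_disk)"
        by (intro measurable_restrict_space1 measurable_completion) simp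
    qed
    also have "\<dots> \<le> I + J"
      unfolding J_def using nn_integral_cauchy_kernel_powr_le[of s z] s z by (intro add_mono) auto
    finally have le: "(\<integral>\<^sup>+\<zeta>. ?N \<zeta> \<partial>lebesgue_on unit_disk) \<le> I + J" .
    have "(LINT \<zeta>:unit_disk|lebesgue. g \<zeta> / k \<zeta>)
        = (LINT \<zeta>|lebesgue_on unit_disk. g \<zeta> / k \<zeta>)"
      by (simp add: set_lebesgue_integral_def integral_restrict_space)
    \<comment> \<open>If the quotient is not integrable, its Bochner integral is 0 and the bound is trivial.\<close>
    moreover have "ennreal (cmod (LINT \<zeta>|lebesgue_on unit_disk. g \<zeta> / k \<zeta>))
        \<le> (\<integral>\<^sup>+\<zeta>. ?N \<zeta> \<partial>lebesgue_on unit_disk)"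
      by (cases "integrable (lebesgue_on unit_disk) (\<lambda>\<zeta>. g \<zeta> / k \<zeta>)")
         (auto intro: integral_norm_bound_ennreal simp: not_integrable_integral_eq)
    ultimately have "ennreal (cmod (LINT \<zeta>:unit_disk|lebesgue. g \<zeta> / k \<zeta>)) \<le> I + J"
      using le by simp
    moreover have "I + J < \<infinity>"
      using fin by (simp add: I_def J_def)
    ultimately show ?thesis
      using enn2real_mono[of "ennreal (cmod (LINT \<zeta>:unit_disk|lebesgue. g \<zeta> / k \<zeta>))" "I + J"]
      by simp
  qed
  then show ?thesis
    by blast
qed

lemma Theodorescu_bounded:
  assumes "2 < q" "A \<in> bc_Lq q"
  obtains M where "\<And>z. z \<in> unit_disk \<Longrightarrow> cmod (bc_plus (Theodorescu A z)) \<le> M"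
    and "\<And>z. z \<in> unit_disk \<Longrightarrow> cmod (bc_minus (Theodorescu A z)) \<le> M"
proof -
  let ?D = "lebesgue_on unit_disk"
  have meas: "(\<lambda>z. bc_plus (A z)) \<in> borel_measurable ?D"
      "(\<lambda>z. bc_minus (A z)) \<in> borel_measurable ?D"
    and fin: "(\<integral>\<^sup>+z. ennreal (bc_norm (A z) powr q) \<partial>?D) < \<infinity>"
    using assms(2) by (auto simp: bc_Lq_def)
  have [measurable]: "(\<lambda>z. bc_norm (A z)) \<in> borel_measurable ?D"
    unfolding bc_norm_def using meas by measurable
  have component: "(\<integral>\<^sup>+z. ennreal (cmod (h (A z)) powr q) \<partial>?D) < \<infinity>"
    if "\<And>w. cmod (h w) \<le> sqrt 2 * bc_norm w" for h
  proof -
    have "(\<integral>\<^sup>+z. ennreal (cmod (h (A z)) powr q) \<partial>?D)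
        \<le> (\<integral>\<^sup>+z. ennreal (sqrt 2 powr q) * ennreal (bc_norm (A z) powr q) \<partial>?D)"
    proof (rule nn_integral_mono)
      fix z
      have "cmod (h (A z)) powr q \<le> (sqrt 2 * bc_norm (A z)) powr q"
        using that assms(1) by (intro powr_mono2) auto
      then show "ennreal (cmod (h (A z)) powr q)
          \<le> ennreal (sqrt 2 powr q) * ennreal (bc_norm (A z) powr q)"
        by (simp add: powr_mult bc_norm_nonneg ennreal_mult[symmetric] ennreal_leI)
    qed
    also have "\<dots> = ennreal (sqrt 2 powr q) * (\<integral>\<^sup>+z. ennreal (bc_norm (A z) powr q) \<partial>?D)"
      by (rule nn_integral_cmult) measurable
    also have "\<dots> < \<infinity>"
      using fin by (simp add: ennreal_mult_less_top)
    finally show ?thesis .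
  qed
  obtain M1 where M1: "\<And>z k. z \<in> unit_disk \<Longrightarrow> (\<And>\<zeta>. cmod (k \<zeta>) = cmod (\<zeta> - z)) \<Longrightarrow>
      cmod (LINT \<zeta>:unit_disk|lebesgue. bc_plus (A \<zeta>) / k \<zeta>) \<le> M1"
    using cauchy_kernel_integral_bounded[OF assms(1) meas(1) component[OF cmod_bc_plus_le]] by blast
  obtain M2 where M2: "\<And>z k. z \<in> unit_disk \<Longrightarrow> (\<And>\<zeta>. cmod (k \<zeta>) = cmod (\<zeta> - z)) \<Longrightarrow>
      cmod (LINT \<zeta>:unit_disk|lebesgue. bc_minus (A \<zeta>) / k \<zeta>) \<le> M2"
    using cauchy_kernel_integral_bounded[OF assms(1) meas(2) component[OF cmod_bc_minus_le]] by blast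
  have conj_kernel: "cmod (cnj \<zeta> - cnj z) = cmod (\<zeta> - z)" for \<zeta> z
    by (metis complex_cnj_diff complex_mod_cnj)
  show thesis
  proof
    fix z assume z: "z \<in> unit_disk"
    show "cmod (bc_plus (Theodorescu A z)) \<le> max M1 M2 / pi"
      using M1[OF z conj_kernel]
      by (simp add: Theodorescu_def bc_plus_idempotent_sum norm_mult norm_divide divide_right_mono)
    show "cmod (bc_minus (Theodorescu A z)) \<le> max M1 M2 / pi"
      using M2[OF z refl]
      by (simp add: Theodorescu_def bc_minus_idempotent_sum norm_mult norm_divide divide_right_mono)
  qed
qed

section \<open>Comparison of Hardy norms\<close>

lemma integrable_bc_norm_circle:
  assumes "bc_continuous_on_disk f" "0 < r" "r < 1" "0 < p"
  shows "set_integrable lborel {0..2*pi}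
    (\<lambda>\<theta>. bc_norm (f (complex_of_real r * exp (\<i> * complex_of_real \<theta>))) powr p)"
proof (rule borel_integrable_compact[unfolded set_integrable_def[symmetric]])
  have circle: "continuous_on {0..2*pi} (\<lambda>\<theta>. h (complex_of_real r * exp (\<i> * complex_of_real \<theta>)))"
    if "continuous_on unit_disk h" for h :: "complex \<Rightarrow> complex"
    using assms by (intro continuous_on_compose2[OF that] continuous_intros) (auto simp: norm_mult)
  show "continuous_on {0..2*pi}
      (\<lambda>\<theta>. bc_norm (f (complex_of_real r * exp (\<i> * complex_of_real \<theta>))) powr p)"
    using assms unfolding bc_continuous_on_disk_def bc_norm_def
    by (intro continuous_intros continuous_on_powr' circle) auto
qed simp

text \<open>
  Continuity matters because the circle means are Bochner integrals: if \<open>h\<close> were not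
  integrable on a circle, its mean there would be 0 and would not control that of \<open>g\<close>.
\<close>

lemma bc_Hardy_norm_le:
  assumes "0 < p" "0 \<le> C" "bc_continuous_on_disk g" "bc_continuous_on_disk h"
    and le: "\<And>z. z \<in> unit_disk \<Longrightarrow> bc_norm (g z) \<le> C * bc_norm (h z)"
  shows "bc_Hardy_norm p g \<le> ennreal C * bc_Hardy_norm p h"
proof -
  define m where "m = (\<lambda>f r. LINT \<theta>:{0..2*pi}|lborel.
      bc_norm (f (complex_of_real r * exp (\<i> * complex_of_real \<theta>))) powr p)"
  have m_nonneg: "0 \<le> m f r" for f r
    unfolding m_def set_lebesgue_integral_def by (intro integral_nonneg_AE) auto
  have radius: "ennreal (m g r powr (1/p)) \<le> ennreal C * bc_Hardy_norm p h"
    if r: "r \<in> {0<..<1}" for r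
  proof -
    have "m g r \<le> (LINT \<theta>:{0..2*pi}|lborel.
        C powr p * bc_norm (h (complex_of_real r * exp (\<i> * complex_of_real \<theta>))) powr p)"
      unfolding m_def
    proof (rule set_integral_mono)
      fix \<theta>
      let ?z = "complex_of_real r * exp (\<i> * complex_of_real \<theta>)"
      have "bc_norm (g ?z) powr p \<le> (C * bc_norm (h ?z)) powr p"
        using r assms(1) by (intro powr_mono2 le) (auto simp: norm_mult bc_norm_nonneg)
      then show "bc_norm (g ?z) powr p \<le> C powr p * bc_norm (h ?z) powr p"
        using assms(2) by (simp add: powr_mult bc_norm_nonneg)
    qed (use r assms in \<open>auto intro!: integrable_bc_norm_circle set_integrable_mult_right\<close>)
    also have "\<dots> = C powr p * m h r"
      by (simp add: m_def)
    finally have "m g r powr (1/p) \<le> (C powr p * m h r) powr (1/p)"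
      using assms(1) m_nonneg by (intro powr_mono2) auto
    also have "\<dots> = C * m h r powr (1/p)"
      using assms(1,2) m_nonneg by (simp add: powr_mult powr_powr)
    finally have "ennreal (m g r powr (1/p)) \<le> ennreal C * ennreal (m h r powr (1/p))"
      using assms(2) by (simp add: ennreal_mult[symmetric] ennreal_leI)
    also have "ennreal (m h r powr (1/p)) \<le> bc_Hardy_norm p h"
      unfolding bc_Hardy_norm_def m_def using r by (rule SUP_upper)
    finally show ?thesis
      by (simp add: mult_left_mono)
  qed
  show ?thesis
    unfolding bc_Hardy_norm_def[of p g] by (intro SUP_least radius[unfolded m_def])
qed

theorem theorem4p6:
  fixes p q :: real and A f \<phi> :: "complex \<Rightarrow> bicomplex"
  assumes "0 < p" and "2 < q" and "A \<in> bc_Lq q"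
    and "f \<in> bc_H A"
    and "\<phi> \<in> bc_Hol"
    and "\<And>z. z \<in> unit_disk \<Longrightarrow> f z = \<phi> z * bc_exp (Theodorescu A z)"
  shows "f \<in> bc_H_Hardy p A \<longleftrightarrow> \<phi> \<in> bc_Hardy p"
proof -
  obtain M where M: "\<And>z. z \<in> unit_disk \<Longrightarrow> cmod (bc_plus (Theodorescu A z)) \<le> M"
      "\<And>z. z \<in> unit_disk \<Longrightarrow> cmod (bc_minus (Theodorescu A z)) \<le> M"
    using Theodorescu_bounded[OF assms(2,3)] by blast
  have continuous: "bc_continuous_on_disk f" "bc_continuous_on_disk \<phi>"
    using assms(4,5) by (auto simp: bc_H_def bc_Hol_def)
  have exp_upper: "cmod (v * exp t) \<le> exp M * cmod v"
    and exp_lower: "cmod v \<le> exp M * cmod (v * exp t)" if "cmod t \<le> M" for v t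
  proof -
    have Re: "\<bar>Re t\<bar> \<le> M"
      using that abs_Re_le_cmod order_trans by blast
    then show "cmod (v * exp t) \<le> exp M * cmod v"
      by (simp add: norm_mult mult_left_mono mult.commute[of "exp M"])
    have "1 \<le> exp (M + Re t)"
      using Re by simp
    then show "cmod v \<le> exp M * cmod (v * exp t)"
      using mult_left_mono[of 1 "exp (M + Re t)" "cmod v"]
      by (simp add: norm_mult exp_add mult_ac)
  qed
  have components: "bc_plus (f z) = bc_plus (\<phi> z) * exp (bc_plus (Theodorescu A z))"
      "bc_minus (f z) = bc_minus (\<phi> z) * exp (bc_minus (Theodorescu A z))"
    if "z \<in> unit_disk" for z
    using assms(6)[OF that]
    by (simp_all add: bc_exp_def bc_plus_mult bc_minus_mult
        bc_plus_idempotent_sum bc_minus_idempotent_sum)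
  have "bc_Hardy_norm p f \<le> ennreal (exp M) * bc_Hardy_norm p \<phi>"
    using assms(1) continuous M components exp_upper
    by (intro bc_Hardy_norm_le bc_norm_le_mult) auto
  moreover have "bc_Hardy_norm p \<phi> \<le> ennreal (exp M) * bc_Hardy_norm p f"
    using assms(1) continuous M components exp_lower
    by (intro bc_Hardy_norm_le bc_norm_le_mult) auto
  ultimately have "bc_Hardy_norm p f < \<infinity> \<longleftrightarrow> bc_Hardy_norm p \<phi> < \<infinity>"
    by (metis ennreal_less_top ennreal_mult_less_top infinity_ennreal_def order_le_less_trans)
  then show ?thesis
    using assms(4,5) by (simp add: bc_H_Hardy_def bc_Hardy_def)
qed

end
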